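(* As formal power series in $x$ with coefficients in $\mathbb{Z}[t]$, $$\sum_{n\geq 0}\ \sum_{T\in \mathcal{PT}(n)} t^{\operatorname{urc}(T)} x^n = \frac{1+E_t(x)}{1+(t-1)\,x\,E_t(x)},\qquad\text{where}\qquad E_t(x)=\sum_{n\geq 1} n\,(t)_{n-1}\,x^n .$$
   Context: Rising factorial: $(t)_0=1$ and $(t)_n=t(t+1)\cdots(t+n-1)$ for $n\ge 1$. Ferrers diagrams: a Ferrers diagram is a left-justified arrangement of square cells, possibly with empty rows; its length is the number of rows plus the number of columns. The steps of the south-east border are labeled $1,\dots,n$ from north-east to south-west ($n$ the length); a row gets the label of its south step and a column the label of its west step. Equivalently, a diagram of length $n$ is a splitting of $\{1,\dots,n\}$ into row labels and column labels; rows are listed top to bottom in increasing order of label, columns left to right in decreasing order of label, and there is a cell in Row $r$ and Column $c$ exactly when $r<c$. Permutation tableaux: a permutation tableau is a Ferrers diagram with a filling of its cells by $0$'s and $1$'s such that (1) each column has at least one $1$; (2) there is no $0$ having both a $1$ above it in the same column and a $1$ to the left of it in the same row. $\mathcal{PT}(n)$ is the set of permutation tableaux of length $n$ ($\mathcal{PT}(0)$ consists of the single empty tableau). A column is unrestricted if it contains no $0$ that has a $1$ to the left of it in the same row; $\operatorname{urc}(T)$ is the number of unrestricted columns of $T$. *)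

theory Defs
  imports
    "HOL-Computational_Algebra.Polynomial"
    "HOL-Computational_Algebra.Formal_Power_Series"
    "HOL-Library.FuncSet"
begin

text \<open>A Ferrers diagram is represented by the labels of its rows and of its columns.
  Smaller row labels are further up, larger column labels are further to the left.\<close>

record ferrers =
  row_labels :: "nat set"
  col_labels :: "nat set"

definition ferrers_diagrams :: "nat \<Rightarrow> ferrers set" where
  "ferrers_diagrams n =
     {D. row_labels D \<union> col_labels D = {1..n} \<and> row_labels D \<inter> col_labels D = {}}"

definition cells :: "ferrers \<Rightarrow> (nat \<times> nat) set" where
  "cells D = {(r, c). r \<in> row_labels D \<and> c \<in> col_labels D \<and> r < c}"

text \<open>A filling assigns an entry to each cell \<open>(r, c)\<close>; it is extensional (equal to
  \<^const>\<open>undefined\<close> outside the cells), so that distinct functions are distinct fillings.\<close>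

definition fillings :: "ferrers \<Rightarrow> (nat \<times> nat \<Rightarrow> nat) set" where
  "fillings D = cells D \<rightarrow>\<^sub>E {0, 1}"

type_synonym tableau = "ferrers \<times> (nat \<times> nat \<Rightarrow> nat)"

definition one_above :: "tableau \<Rightarrow> nat \<Rightarrow> nat \<Rightarrow> bool" where
  "one_above T r c \<longleftrightarrow> (\<exists>r'. r' < r \<and> (r', c) \<in> cells (fst T) \<and> snd T (r', c) = 1)"

definition one_to_left :: "tableau \<Rightarrow> nat \<Rightarrow> nat \<Rightarrow> bool" where
  "one_to_left T r c \<longleftrightarrow> (\<exists>c'. c < c' \<and> (r, c') \<in> cells (fst T) \<and> snd T (r, c') = 1)"

definition permutation_tableaux :: "nat \<Rightarrow> tableau set" where
  "permutation_tableaux n =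
     {T. fst T \<in> ferrers_diagrams n \<and> snd T \<in> fillings (fst T) \<and>
         (\<forall>c \<in> col_labels (fst T). \<exists>r. (r, c) \<in> cells (fst T) \<and> snd T (r, c) = 1) \<and>
         \<not> (\<exists>(r, c) \<in> cells (fst T). snd T (r, c) = 0 \<and> one_above T r c \<and> one_to_left T r c)}"

definition unrestricted_column :: "tableau \<Rightarrow> nat \<Rightarrow> bool" where
  "unrestricted_column T c \<longleftrightarrow> c \<in> col_labels (fst T) \<and>
     \<not> (\<exists>r. (r, c) \<in> cells (fst T) \<and> snd T (r, c) = 0 \<and> one_to_left T r c)"

definition urc :: "tableau \<Rightarrow> nat" where
  "urc T = card {c. unrestricted_column T c}"

lemma finite_permutation_tableaux: "finite (permutation_tableaux n)"
proof (rule finite_subset)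
  let ?F = "(\<lambda>(R, C). \<lparr>row_labels = R, col_labels = C\<rparr>) ` (Pow {1..n} \<times> Pow {1..n})"
  have F: "ferrers_diagrams n \<subseteq> ?F"
  proof
    fix D assume "D \<in> ferrers_diagrams n"
    then have "(row_labels D, col_labels D) \<in> Pow {1..n} \<times> Pow {1..n}"
      by (auto simp: ferrers_diagrams_def)
    then show "D \<in> ?F"
      by (intro image_eqI[of _ _ "(row_labels D, col_labels D)"]) simp_all
  qed
  show "permutation_tableaux n \<subseteq> Sigma (ferrers_diagrams n) fillings"
    by (auto simp: permutation_tableaux_def)
  have "finite (fillings D)" if "D \<in> ferrers_diagrams n" for D
  proof -
    have "cells D \<subseteq> {1..n} \<times> {1..n}"
      using that by (auto simp: cells_def ferrers_diagrams_def)
    then have "finite (cells D)"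
      by (rule finite_subset) simp
    then show ?thesis
      unfolding fillings_def by (intro finite_PiE) auto
  qed
  then show "finite (Sigma (ferrers_diagrams n) fillings)"
    using finite_subset[OF F] by (intro finite_SigmaI) auto
qed

text \<open>The coefficient ring is \<^typ>\<open>int poly\<close>, and \<open>poly_t\<close> is its indeterminate \<open>t\<close>.\<close>

definition poly_t :: "int poly" where
  "poly_t = [:0, 1:]"

definition E_t :: "int poly fps" where
  "E_t = Abs_fps (\<lambda>n. if n \<ge> 1 then of_nat n * pochhammer poly_t (n - 1) else 0)"

text \<open>\<^typ>\<open>int poly\<close> is not a field, so the library's division of power series is not available
  over it.  A quotient whose denominator has constant coefficient \<open>1\<close> is taken by means of
  \<open>fps_right_inverse g 1\<close>, the power series inverse of \<open>g\<close> built from the inverse \<open>1\<close> of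
  its constant coefficient.\<close>

definition fps_quotient :: "'a::comm_ring_1 fps \<Rightarrow> 'a fps \<Rightarrow> 'a fps" where
  "fps_quotient f g = f * fps_right_inverse g 1"

lemma fps_quotient_eq_iff:
  fixes f g h :: "'a::comm_ring_1 fps"
  assumes "fps_nth g 0 = 1"
  shows "h = fps_quotient f g \<longleftrightarrow> g * h = f"
proof -
  have inv: "g * fps_right_inverse g 1 = 1"
    using assms by (intro fps_right_inverse) simp
  show ?thesis
  proof
    assume h: "h = fps_quotient f g"
    have "g * h = f * (g * fps_right_inverse g 1)"
      unfolding h fps_quotient_def by (simp only: mult.left_commute)
    with inv show "g * h = f" by simp
  next
    assume f: "g * h = f"
    have "fps_quotient f g = h * (g * fps_right_inverse g 1)"
      unfolding f[symmetric] fps_quotient_def by (simp only: mult_ac)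
    with inv show "h = fps_quotient f g" by simp
  qed
qed

lemma denominator_nth_0:
  "fps_nth (1 + fps_const (poly_t - 1) * fps_X * E_t) 0 = 1"
  by simp

end

(* Build a tableau label by label from the north-east, i.e. by adding empty rows at the bottom and
   columns at the left, and remember which rows are "open": those that will receive a 1 in a later
   column.  Whether a column is unrestricted is then known when it is added, since a 0 in it has a 1
   to its left in the finished tableau only through an open row or a 1 already placed.  With weight
   t^urc a^(number of open rows), adding a label acts on the generating function W_n(a) by
     W_{n+1}(a) = (t + a) W_n(a + 1) + (1 - t) W_n(0),
   where W_n(0) counts the tableaux without open rows, i.e. the permutation tableaux.  The first
   term alone would iterate to (t + a)_n, so with R = sum_n (t)_n x^n and P = sum_n W_n(0) x^n one
   obtains P (1 + (t - 1) x R) = R.  Since 1 + E_t = (1 - (t - 1) x) R, this is the theorem. *)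

theory Submission
  imports Defs
begin

section \<open>Open tableaux and their weights\<close>

definition left_one :: "(nat \<times> nat) set \<Rightarrow> nat set \<Rightarrow> nat \<Rightarrow> nat \<Rightarrow> bool" where
  "left_one X S r c \<longleftrightarrow> r \<in> S \<or> (\<exists>c'>c. (r, c') \<in> X)"

text \<open>In \<open>(R, X, S)\<close>, \<open>R\<close> is the set of rows, \<open>X\<close> the set of cells containing a 1, and \<open>S\<close> the
  set of open rows, which count as having a 1 to the left of every cell.\<close>

definition open_tableaux :: "nat \<Rightarrow> (nat set \<times> (nat \<times> nat) set \<times> nat set) set" where
  "open_tableaux n = {(R, X, S). R \<subseteq> {1..n} \<and> S \<subseteq> R \<and>
     (\<forall>r c. (r, c) \<in> X \<longrightarrow> r \<in> R \<and> c \<in> {1..n} - R \<and> r < c) \<and>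
     (\<forall>c\<in>{1..n} - R. \<exists>r. (r, c) \<in> X) \<and>
     (\<forall>r c r'. r \<in> R \<longrightarrow> c \<in> {1..n} - R \<longrightarrow> r < c \<longrightarrow> (r, c) \<notin> X \<longrightarrow> r' < r \<longrightarrow>
        (r', c) \<in> X \<longrightarrow> \<not> left_one X S r c)}"

text \<open>These are the columns that become unrestricted in every completion: each open row will
  receive a 1 further left, so the final status of a column is already decided. When
  \<open>S\<close> is empty they are the unrestricted columns of the tableau itself.\<close>

definition free_columns :: "nat \<Rightarrow> nat set \<times> (nat \<times> nat) set \<times> nat set \<Rightarrow> nat set" where
  "free_columns n = (\<lambda>(R, X, S). {c \<in> {1..n} - R.
     \<forall>r\<in>R. r < c \<longrightarrow> (r, c) \<notin> X \<longrightarrow> \<not> left_one X S r c})"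

definition open_weight ::
  "'a::comm_ring_1 \<Rightarrow> 'a \<Rightarrow> nat \<Rightarrow> nat set \<times> (nat \<times> nat) set \<times> nat set \<Rightarrow> 'a" where
  "open_weight t a n q = t ^ card (free_columns n q) * a ^ card (snd (snd q))"

definition open_sum :: "'a::comm_ring_1 \<Rightarrow> nat \<Rightarrow> 'a \<Rightarrow> 'a" where
  "open_sum t n a = (\<Sum>q\<in>open_tableaux n. open_weight t a n q)"

lemma finite_open_tableaux: "finite (open_tableaux n)"
proof (rule finite_subset)
  show "open_tableaux n \<subseteq> Pow {1..n} \<times> Pow ({1..n} \<times> {1..n}) \<times> Pow {1..n}"
    by (fastforce simp: open_tableaux_def)
qed simp

lemma open_tableauxI:
  assumes "R \<subseteq> {1..n}" "S \<subseteq> R"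
    and "\<And>r c. (r, c) \<in> X \<Longrightarrow> r \<in> R \<and> c \<in> {1..n} - R \<and> r < c"
    and "\<And>c. c \<in> {1..n} - R \<Longrightarrow> \<exists>r. (r, c) \<in> X"
    and "\<And>r c r'. r \<in> R \<Longrightarrow> c \<in> {1..n} - R \<Longrightarrow> r < c \<Longrightarrow> (r, c) \<notin> X \<Longrightarrow> r' < r \<Longrightarrow>
      (r', c) \<in> X \<Longrightarrow> \<not> left_one X S r c"
  shows "(R, X, S) \<in> open_tableaux n"
  using assms unfolding open_tableaux_def by blast

lemma open_tableauxD:
  assumes "(R, X, S) \<in> open_tableaux n"
  shows "R \<subseteq> {1..n}" "S \<subseteq> R"
    and "\<And>r c. (r, c) \<in> X \<Longrightarrow> r \<in> R \<and> c \<in> {1..n} - R \<and> r < c"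
    and "\<And>c. c \<in> {1..n} - R \<Longrightarrow> \<exists>r. (r, c) \<in> X"
    and "\<And>r c r'. r \<in> R \<Longrightarrow> c \<in> {1..n} - R \<Longrightarrow> r < c \<Longrightarrow> (r, c) \<notin> X \<Longrightarrow> r' < r \<Longrightarrow>
      (r', c) \<in> X \<Longrightarrow> \<not> left_one X S r c"
  using assms unfolding open_tableaux_def by blast+

section \<open>Adding an empty row at the bottom\<close>

text \<open>All columns present have labels smaller than \<open>Suc n\<close>, so the row
  \<open>Suc n\<close> has no cell yet. It can violate no condition, and it may be opened or left
  closed freely.\<close>

lemma open_tableaux_insert_row:
  assumes R: "R \<subseteq> {1..n}" and S: "S \<subseteq> insert (Suc n) R"
  shows "(insert (Suc n) R, X, S) \<in> open_tableaux (Suc n) \<longleftrightarrow> (R, X, S - {Suc n}) \<in> open_tableaux n"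
proof
  have C: "{1..Suc n} - insert (Suc n) R = {1..n} - R" by auto
  have L: "left_one X (S - {Suc n}) r c \<longleftrightarrow> left_one X S r c" if "r \<in> R" for r c
    using that R by (auto simp: left_one_def)
  {
    assume "(insert (Suc n) R, X, S) \<in> open_tableaux (Suc n)"
    note D = open_tableauxD[OF this, unfolded C]
    show "(R, X, S - {Suc n}) \<in> open_tableaux n"
    proof (rule open_tableauxI)
      show "r \<in> R \<and> c \<in> {1..n} - R \<and> r < c" if "(r, c) \<in> X" for r c
        using D(3)[OF that] by auto
      show "\<not> left_one X (S - {Suc n}) r c"
        if "r \<in> R" "c \<in> {1..n} - R" "r < c" "(r, c) \<notin> X" "r' < r" "(r', c) \<in> X" for r c r'
        using D(5)[of r c r'] L that by blast
    qed (use R S D(4) in auto)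
  }
  {
    assume "(R, X, S - {Suc n}) \<in> open_tableaux n"
    note D = open_tableauxD[OF this]
    show "(insert (Suc n) R, X, S) \<in> open_tableaux (Suc n)"
    proof (rule open_tableauxI, unfold C)
      show "r \<in> insert (Suc n) R \<and> c \<in> {1..n} - R \<and> r < c" if "(r, c) \<in> X" for r c
        using D(3)[OF that] by auto
      show "\<not> left_one X S r c"
        if "r \<in> insert (Suc n) R" "c \<in> {1..n} - R" "r < c" "(r, c) \<notin> X" "r' < r" "(r', c) \<in> X"
        for r c r'
      proof -
        have "r \<in> R" using that by auto
        then show ?thesis using D(5)[of r c r'] L that by blast
      qed
      show "insert (Suc n) R \<subseteq> {1..Suc n}" using R by auto
    qed (use S D(4) in blast)+
  }
qed

lemma free_columns_insert_row:
  assumes R: "R \<subseteq> {1..n}"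
  shows "free_columns (Suc n) (insert (Suc n) R, X, S) = free_columns n (R, X, S - {Suc n})"
proof -
  have C: "{1..Suc n} - insert (Suc n) R = {1..n} - R" by auto
  have L: "left_one X (S - {Suc n}) r c \<longleftrightarrow> left_one X S r c" if "r \<in> R" for r c
    using that R by (auto simp: left_one_def)
  show ?thesis
    unfolding free_columns_def prod.case C by (intro Collect_cong conj_cong refl) (simp add: L)
qed

lemma open_tableaux_finite_rows:
  assumes "(R, X, S) \<in> open_tableaux n"
  shows "finite R" "finite S"
proof -
  have "R \<subseteq> {1..n}" "S \<subseteq> R" using assms by (auto simp: open_tableaux_def)
  then show "finite R" "finite S" by (meson finite_atLeastAtMost finite_subset)+
qed

lemma finite_free_columns: "finite (free_columns n q)"
  by (cases q) (simp add: free_columns_def)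

section \<open>Sums over subsets and initial segments\<close>

lemma sum_Pow_power_card:
  fixes a :: "'a::comm_ring_1"
  assumes "finite A"
  shows "(\<Sum>V\<in>Pow A. a ^ card V) = (1 + a) ^ card A"
  using prod_add[OF assms, of "\<lambda>_. a" "\<lambda>_. 1"] by (simp add: add.commute)

text \<open>If \<open>m\<close> runs through \<open>S\<close> in increasing order, this is the
  geometric sum of a^i (1 + a)^(s - i) for i < s, where s = \<open>card S\<close>; it telescopes
  because (1 + a) - a = 1. The induction removes the largest element, which lies in the upper
  segment of every \<open>m\<close>.\<close>

lemma sum_initial_segments:
  fixes a :: "'a::comm_ring_1" and S :: "nat set"
  assumes "finite S"
  shows "(\<Sum>m\<in>S. a ^ card {r\<in>S. r < m} * (1 + a) ^ card {r\<in>S. m \<le> r}) =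
    (1 + a) * ((1 + a) ^ card S - a ^ card S)"
  using assms
proof (induction S rule: finite_linorder_max_induct)
  case (insert b A)
  have b: "b \<notin> A" using insert by auto
  have "{r \<in> insert b A. r < m} = {r \<in> A. r < m}"
    "{r \<in> insert b A. m \<le> r} = insert b {r \<in> A. m \<le> r}" if "m \<in> A" for m
    using insert(2) that by auto
  then have 1: "(\<Sum>m\<in>A. a ^ card {r\<in>insert b A. r < m} * (1 + a) ^ card {r\<in>insert b A. m \<le> r}) =
    (\<Sum>m\<in>A. (1 + a) * (a ^ card {r\<in>A. r < m} * (1 + a) ^ card {r\<in>A. m \<le> r}))"
    using b insert(1) by (intro sum.cong) (simp_all add: algebra_simps)
  have 2: "{r \<in> insert b A. r < b} = A" "{r \<in> insert b A. b \<le> r} = {b}"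
    using insert(2) by fastforce+
  show ?case
    using b insert(1) unfolding sum.insert[OF insert(1) b] 1 2 sum_distrib_left[symmetric] insert.IH
    by (simp add: algebra_simps)
qed simp

text \<open>The weight differs from 1 only at \<open>m = Min S\<close>, where the summand is (1 +
  a)^(card S). For empty \<open>S\<close> the left side is 0 while the first two terms on the right
  give t - 1; the last term corrects this and is the source of the summand (1 - t) W_n(0) in the
  recurrence.\<close>

lemma sum_initial_segments_weighted:
  fixes a t :: "'a::comm_ring_1" and S :: "nat set"
  assumes "finite S"
  shows "(\<Sum>m\<in>S. (if {r\<in>S. r < m} = {} then t else 1) *
      (a ^ card {r\<in>S. r < m} * (1 + a) ^ card {r\<in>S. m \<le> r})) =
    (a + t) * (1 + a) ^ card S - (1 + a) * a ^ card S + (if S = {} then 1 - t else 0)"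
proof (cases "S = {}")
  case False
  let ?f = "\<lambda>m. a ^ card {r\<in>S. r < m} * (1 + a) ^ card {r\<in>S. m \<le> r}"
  have min: "Min S \<in> S" "{r\<in>S. r < Min S} = {}" "{r\<in>S. Min S \<le> r} = S"
    using assms False by (auto simp: not_less)
  have e: "{r\<in>S. r < m} = {} \<longleftrightarrow> m = Min S" if "m \<in> S" for m
    using that min assms by (auto simp: not_less intro: antisym)
  have "(\<Sum>m\<in>S. (if {r\<in>S. r < m} = {} then t else 1) * ?f m) =
    (\<Sum>m\<in>S. ?f m + (if m = Min S then (t - 1) * ?f m else 0))"
    by (intro sum.cong refl) (simp only: e, simp add: algebra_simps)
  also have "\<dots> = (1 + a) * ((1 + a) ^ card S - a ^ card S) + (t - 1) * ?f (Min S)"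
    using assms min(1) by (simp add: sum.distrib sum_initial_segments)
  also have "?f (Min S) = (1 + a) ^ card S"
    unfolding min by simp
  finally show ?thesis using False by (simp add: algebra_simps)
qed (simp add: algebra_simps)

section \<open>Splitting the weighted sum by the type of the last label\<close>

text \<open>\<open>V\<close> records the choice made for the new row: empty if it is closed,
  \<open>{Suc n}\<close> if it is open. Summing over \<open>V\<close> turns this into a factor 1 +
  a.\<close>

lemma open_sum_rows:
  fixes a t :: "'a::comm_ring_1"
  shows "(\<Sum>q\<in>{q \<in> open_tableaux (Suc n). Suc n \<in> fst q}. open_weight t a (Suc n) q) =
    (\<Sum>(q, V)\<in>open_tableaux n \<times> Pow {Suc n}. open_weight t a n q * a ^ card V)"
    (is "sum _ ?A = sum _ ?B")
proof -
  let ?i = "\<lambda>((R, X, S), V). (insert (Suc n) R, X, S \<union> V)"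
  let ?j = "\<lambda>(R, X, S). ((R - {Suc n}, X, S - {Suc n}), S \<inter> {Suc n})"
  have mem: "Suc n \<notin> R" "Suc n \<notin> S" "finite S" if "(R, X, S) \<in> open_tableaux n" for R X S
    using that open_tableaux_finite_rows[OF that] by (auto simp: open_tableaux_def)
  show ?thesis
  proof (rule sum.reindex_bij_witness[of _ ?i ?j])
    show "?i (?j q) = q" if "q \<in> ?A" for q
      using that by (auto simp: open_tableaux_def)
    show "?j (?i p) = p" if "p \<in> ?B" for p
      using that mem by fastforce
    show "?j q \<in> ?B" if "q \<in> ?A" for q
    proof -
      obtain R X S where q: "q = (R, X, S)" by (cases q)
      have R: "insert (Suc n) (R - {Suc n}) = R" "S \<subseteq> R" "R \<subseteq> {1..Suc n}"
        using that open_tableauxD[of R X S "Suc n"] unfolding q by auto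
      then have "R - {Suc n} \<subseteq> {1..n}" by (auto simp: le_Suc_eq)
      with open_tableaux_insert_row[OF this, of S X] that R show ?thesis unfolding q by auto
    qed
    show "?i p \<in> ?A" if "p \<in> ?B" for p
    proof -
      obtain R X S V where p: "p = ((R, X, S), V)" by (cases p) auto
      have q: "(R, X, S) \<in> open_tableaux n" and V: "V \<subseteq> {Suc n}" using that p by auto
      have "S \<union> V - {Suc n} = S" using V mem[OF q] by auto
      then show ?thesis
        using open_tableaux_insert_row[of R n "S \<union> V" X] open_tableauxD[OF q] V q unfolding p by auto
    qed
    show "(case ?j q of (q, V) \<Rightarrow> open_weight t a n q * a ^ card V) = open_weight t a (Suc n) q"
      if "q \<in> ?A" for q
    proof -
      obtain R X S where q: "q = (R, X, S)" by (cases q)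
      have R: "insert (Suc n) (R - {Suc n}) = R" "R \<subseteq> {1..Suc n}"
        using that open_tableauxD[of R X S "Suc n"] unfolding q by auto
      then have "R - {Suc n} \<subseteq> {1..n}" by (auto simp: le_Suc_eq)
      then have "free_columns (Suc n) q = free_columns n (R - {Suc n}, X, S - {Suc n})"
        using free_columns_insert_row[of "R - {Suc n}" n X S] unfolding q R(1) by blast
      moreover have "finite S" using that q open_tableaux_finite_rows by blast
      then have "card S = card (S - {Suc n}) + card (S \<inter> {Suc n})"
        by (simp add: card_Diff_subset_Int card_mono)
      ultimately show ?thesis by (simp add: q open_weight_def power_add mult_ac)
    qed
  qed
qed

text \<open>In a new leftmost column a 0 in a row that stays open must not have a 1 above it.  Hence the
  ones of that column are exactly the previously open rows from some open row \<open>m\<close> on; \<open>V\<close> is the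
  set of those among them that stay open.  The column is unrestricted iff \<open>m\<close> is the topmost
  previously open row.\<close>

lemma open_sum_columns:
  fixes a t :: "'a::comm_ring_1"
  shows "(\<Sum>q\<in>{q \<in> open_tableaux (Suc n). Suc n \<notin> fst q}. open_weight t a (Suc n) q) =
    (\<Sum>((R, X, S), m, V) \<in> (SIGMA q:open_tableaux n. SIGMA m:snd (snd q). Pow {r\<in>snd (snd q). m \<le> r}).
       t ^ card (free_columns n (R, X, S)) * ((if {r\<in>S. r < m} = {} then t else 1) *
         (a ^ card {r\<in>S. r < m} * a ^ card V)))"
    (is "sum _ ?A = sum _ ?B")
proof -
  let ?N = "Suc n"
  \<comment> \<open>\<open>?i\<close> writes the ones of the new column and closes the rows from
    \<open>m\<close> on that are not in \<open>V\<close>. Conversely \<open>?j\<close> deletes that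
    column and reopens all rows that have a 1 in it; \<open>m\<close> is then its topmost 1.\<close>
  let ?i = "\<lambda>((R, X, S), m, V). (R, X \<union> {r\<in>S. m \<le> r} \<times> {?N}, {r\<in>S. r < m} \<union> V)"
  let ?Y = "\<lambda>X. {r. (r, ?N) \<in> X}"
  let ?j = "\<lambda>(R, X, S). ((R, {p \<in> X. snd p \<noteq> ?N}, S \<union> ?Y X), Min (?Y X), S \<inter> ?Y X)"
  \<comment> \<open>The last two facts determine the shape of the column: among the previously open
    rows \<open>S \<union> ?Y X\<close>, those without a 1 are exactly the ones above its topmost
    1.\<close>
  have A: "finite (?Y X)" "Min (?Y X) \<in> ?Y X" "?Y X \<subseteq> R" "S \<subseteq> R" "?N \<notin> R" "finite S"
     "{r \<in> S \<union> ?Y X. r < Min (?Y X)} = S - ?Y X" "{r \<in> S \<union> ?Y X. Min (?Y X) \<le> r} = ?Y X"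
    if "(R, X, S) \<in> ?A" for R X S
  proof -
    have D: "(R, X, S) \<in> open_tableaux ?N" and N: "?N \<notin> R" using that by auto
    note D = open_tableauxD[OF D]
    show 1: "?Y X \<subseteq> R" "S \<subseteq> R" "?N \<notin> R" using D(2,3) N by auto
    have R: "finite R" using that open_tableaux_finite_rows by blast
    show 2: "finite (?Y X)" "finite S" using 1 R finite_subset by blast+
    have "?Y X \<noteq> {}" using D(4)[of ?N] N by auto
    with 2 show 3: "Min (?Y X) \<in> ?Y X" by (intro Min_in)
    have 4: "Min (?Y X) \<le> r" if "r \<in> ?Y X" for r
      using that 2 by simp
    have "r < Min (?Y X)" if "r \<in> S" "r \<notin> ?Y X" for r
    proof (rule ccontr)
      assume "\<not> r < Min (?Y X)"
      then have "Min (?Y X) < r" using that 3 by (metis linorder_neqE_nat)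
      moreover have "r \<in> R" "?N \<in> {1..?N} - R" using that 1 by auto
      moreover from this D(1) have "r < ?N" by (metis DiffE atLeastAtMost_iff le_neq_implies_less subsetD)
      moreover have "left_one X S r ?N" using that by (simp add: left_one_def)
      ultimately show False using D(5)[of r ?N "Min (?Y X)"] 3 that by blast
    qed
    with 4 show "{r \<in> S \<union> ?Y X. r < Min (?Y X)} = S - ?Y X"
      "{r \<in> S \<union> ?Y X. Min (?Y X) \<le> r} = ?Y X"
      by (auto simp: not_less[symmetric])
  qed
  \<comment> \<open>Column \<open>?N\<close> lies to the left of every earlier column, so a 1 in it
    has the same effect on them as an open row.\<close>
  have L: "left_one X S r c \<longleftrightarrow> left_one {p \<in> X. snd p \<noteq> ?N} (S \<union> ?Y X) r c"
    if "c \<le> n" for X S r c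
    using that by (auto simp: left_one_def less_Suc_eq_le)
  show ?thesis
  proof (rule sum.reindex_bij_witness[of _ ?i ?j])
    show "?i (?j q) = q" if "q \<in> ?A" for q
    proof -
      obtain R X S where q: "q = (R, X, S)" by (cases q)
      show ?thesis using A[of R X S] that unfolding q by auto
    qed
    show "?j (?i p) = p" if "p \<in> ?B" for p
    proof -
      obtain R X S m V where p: "p = ((R, X, S), m, V)" by (metis surj_pair)
      have X: "(r, c) \<in> X \<Longrightarrow> c \<le> n" for r c
        using that p open_tableauxD(3)[of R X S n r c] by auto
      have Y: "?Y (X \<union> {r\<in>S. m \<le> r} \<times> {?N}) = {r\<in>S. m \<le> r}"
        using X by fastforce
      have "finite S" using that p open_tableaux_finite_rows by blast
      then have M: "Min {r\<in>S. m \<le> r} = m"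
        using that p by (intro Min_eqI) auto
      show ?thesis using that X unfolding p prod.case Y M by fastforce
    qed
    show "?j q \<in> ?B" if "q \<in> ?A" for q
    proof -
      obtain R X S where q: "q = (R, X, S)" by (cases q)
      note A' = A[of R X S, OF that[unfolded q]]
      have "(R, X, S) \<in> open_tableaux ?N" using that q by simp
      note D = open_tableauxD[OF this]
      have "(R, {p \<in> X. snd p \<noteq> ?N}, S \<union> ?Y X) \<in> open_tableaux n"
      proof (rule open_tableauxI)
        show "R \<subseteq> {1..n}" using D(1) A'(5) by (auto simp: le_Suc_eq)
        show "S \<union> ?Y X \<subseteq> R" using A' by blast
        show "r \<in> R \<and> c \<in> {1..n} - R \<and> r < c" if "(r, c) \<in> {p \<in> X. snd p \<noteq> ?N}" for r c
          using that D(3)[of r c] by auto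
        show "\<exists>r. (r, c) \<in> {p \<in> X. snd p \<noteq> ?N}" if "c \<in> {1..n} - R" for c
          using that D(4)[of c] by auto
        show "\<not> left_one {p \<in> X. snd p \<noteq> ?N} (S \<union> ?Y X) r c"
          if "r \<in> R" "c \<in> {1..n} - R" "r < c" "(r, c) \<notin> {p \<in> X. snd p \<noteq> ?N}" "r' < r"
            "(r', c) \<in> {p \<in> X. snd p \<noteq> ?N}" for r c r'
          using that D(5)[of r c r'] L[of c X S r] by auto
      qed
      then show ?thesis using A' q by auto
    qed
    show "?i p \<in> ?A" if "p \<in> ?B" for p
    proof -
      obtain R X S m V where p: "p = ((R, X, S), m, V)" by (metis surj_pair)
      let ?X = "X \<union> {r\<in>S. m \<le> r} \<times> {?N}" and ?S = "{r\<in>S. r < m} \<union> V"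
      have m: "m \<in> S" "V \<subseteq> {r\<in>S. m \<le> r}" and q: "(R, X, S) \<in> open_tableaux n"
        using that p by auto
      have X: "r \<in> R \<and> c \<in> {1..n} - R \<and> r < c" if "(r, c) \<in> X" for r c
        using open_tableauxD(3)[OF q that] .
      have R: "R \<subseteq> {1..n}" "S \<subseteq> R" using open_tableauxD(1,2)[OF q] .
      have C: "{1..?N} - R = insert ?N ({1..n} - R)" using R by auto
      \<comment> \<open>For earlier columns, every previously open row still counts: either it stays
        open or it has just received a 1 in column \<open>?N\<close>.\<close>
      have L': "left_one ?X ?S r c \<longleftrightarrow> left_one X S r c" if "c \<le> n" for r c
      proof -
        have "left_one ?X ?S r c \<longleftrightarrow> r \<in> S \<and> r < m \<or> r \<in> V \<or> r \<in> S \<and> m \<le> r \<or> (\<exists>c'>c. (r, c') \<in> X)"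
          using le_imp_less_Suc[OF that] unfolding left_one_def by blast
        then show ?thesis using m(2) linorder_not_le[of m r] unfolding left_one_def by blast
      qed
      have "\<not> left_one ?X ?S r c"
        if "r \<in> R" "c \<in> {1..?N} - R" "r < c" "(r, c) \<notin> ?X" "r' < r" "(r', c) \<in> ?X" for r c r'
      proof (cases "c = ?N")
        case True
        with that X have "r' \<in> S" "m \<le> r'" by fastforce+
        \<comment> \<open>A row below \<open>m\<close> without a 1 in the new column was not open
          before, so it is not open now; and no column lies further left.\<close>
        with that True have "r \<notin> S" by auto
        then show ?thesis using True X m by (fastforce simp: left_one_def)
      next
        case False
        with that have "c \<in> {1..n} - R" "(r, c) \<notin> X" "(r', c) \<in> X" by auto
        with that have "\<not> left_one X S r c" using open_tableauxD(5)[OF q, of r c r'] by blast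
        then show ?thesis using L' \<open>c \<in> {1..n} - R\<close> by simp
      qed
      moreover have "\<exists>r. (r, c) \<in> ?X" if "c \<in> {1..?N} - R" for c
        using that m open_tableauxD(4)[OF q, of c] unfolding C by auto
      moreover have "r \<in> R \<and> c \<in> {1..?N} - R \<and> r < c" if "(r, c) \<in> ?X" for r c
        using that X R by fastforce
      moreover have "?S \<subseteq> R" "R \<subseteq> {1..?N}" using R m by auto
      moreover have "?N \<notin> R" using R by auto
      ultimately have "(R, ?X, ?S) \<in> open_tableaux ?N" by (intro open_tableauxI)
      with \<open>?N \<notin> R\<close> show ?thesis unfolding p by simp
    qed
    show "(\<lambda>((R, X, S), m, V). t ^ card (free_columns n (R, X, S)) *
        ((if {r\<in>S. r < m} = {} then t else 1) * (a ^ card {r\<in>S. r < m} * a ^ card V))) (?j q) =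
        open_weight t a (Suc n) q" if "q \<in> ?A" for q
    proof -
      obtain R X S where q: "q = (R, X, S)" by (cases q)
      note A' = A[of R X S, OF that[unfolded q]]
      let ?q = "(R, {p \<in> X. snd p \<noteq> ?N}, S \<union> ?Y X)"
      have "(R, X, S) \<in> open_tableaux ?N" using that q by simp
      note D = open_tableauxD[OF this]
      have X: "r \<in> R \<and> c \<le> ?N" if "(r, c) \<in> X" for r c
        using D(3)[OF that] by simp
      have R: "r < ?N" if "r \<in> R" for r
        using that D(1) A'(5) by (metis atLeastAtMost_iff le_neq_implies_less subsetD)
      have "left_one X S r ?N \<longleftrightarrow> r \<in> S" for r
        unfolding left_one_def using X by (meson not_less)
      \<comment> \<open>Only an open row can make a 0 of the leftmost column restricted, so the
        column is free iff every row that stays open has a 1 in it.\<close>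
      then have N1: "?N \<in> free_columns ?N q \<longleftrightarrow> S - ?Y X = {}"
        unfolding q free_columns_def using A'(4,5) R by auto
      have N2: "c \<in> free_columns ?N q \<longleftrightarrow> c \<in> free_columns n ?q" if "c \<noteq> ?N" for c
      proof (cases "c \<le> n")
        case True
        then have C: "c \<in> {1..?N} - R \<longleftrightarrow> c \<in> {1..n} - R" by auto
        show ?thesis
          unfolding q free_columns_def prod.case mem_Collect_eq L[OF True, of X S] C using that by auto
      qed (use that in \<open>simp add: q free_columns_def\<close>)
      have N3: "?N \<notin> free_columns n ?q" by (simp add: free_columns_def)
      have F: "free_columns ?N q =
          (if S - ?Y X = {} then insert ?N (free_columns n ?q) else free_columns n ?q)"
      proof (rule set_eqI)
        fix c
        show "c \<in> free_columns ?N q \<longleftrightarrow> c \<in> (if S - ?Y X = {} then insert ?N (free_columns n ?q)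
            else free_columns n ?q)"
          using N1 N3 N2[of c] by (cases "c = ?N"; cases "S - ?Y X = {}") simp_all
      qed
      have T: "t ^ card (free_columns ?N q) =
          t ^ card (free_columns n ?q) * (if S - ?Y X = {} then t else 1)"
        unfolding F using N3 by (simp add: finite_free_columns)
      have "card S = card (S - ?Y X) + card (S \<inter> ?Y X)"
        using A'(6) by (simp add: card_Diff_subset_Int card_mono)
      then show ?thesis
        unfolding q open_weight_def T[unfolded q] prod.case A'(7) snd_conv
        by (simp add: power_add mult_ac)
    qed
  qed
qed

section \<open>The recurrence and its solution\<close>

text \<open>A new row contributes (1 + a) W_n(a). A new column contributes (a + t) W_n(1 + a) - (1 +
  a) W_n(a) + (1 - t) W_n(0), and the terms in W_n(a) cancel.\<close>

lemma open_sum_Suc: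
  fixes a t :: "'a::comm_ring_1"
  shows "open_sum t (Suc n) a = (t + a) * open_sum t n (1 + a) + (1 - t) * open_sum t n 0"
proof -
  let ?Q = "open_tableaux n" and ?u = "\<lambda>q. t ^ card (free_columns n q)"
  note fS = open_tableaux_finite_rows(2)
  have fS': "finite (snd (snd q))" if "q \<in> ?Q" for q
    using that fS by (cases q) auto
  have "(\<Sum>q\<in>{q \<in> open_tableaux (Suc n). Suc n \<in> fst q}. open_weight t a (Suc n) q) =
      (\<Sum>q\<in>?Q. open_weight t a n q * (1 + a))"
    unfolding open_sum_rows sum.cartesian_product[symmetric] sum_distrib_left[symmetric]
    by (simp add: sum_Pow_power_card)
  moreover have "(\<Sum>q\<in>{q \<in> open_tableaux (Suc n). Suc n \<notin> fst q}. open_weight t a (Suc n) q) =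
      (\<Sum>(R, X, S)\<in>?Q. ?u (R, X, S) * ((a + t) * (1 + a) ^ card S - (1 + a) * a ^ card S
         + (if S = {} then 1 - t else 0)))"
  proof -
    let ?g = "\<lambda>q m V. ?u q * ((if {r\<in>snd (snd q). r < m} = {} then t else 1) *
         (a ^ card {r\<in>snd (snd q). r < m} * a ^ card V))"
    let ?P = "\<lambda>q m. Pow {r \<in> snd (snd q). m \<le> r}"
    have "(\<Sum>q\<in>{q \<in> open_tableaux (Suc n). Suc n \<notin> fst q}. open_weight t a (Suc n) q) =
        (\<Sum>(q, m, V)\<in>(SIGMA q:?Q. SIGMA m:snd (snd q). ?P q m). ?g q m V)"
      unfolding open_sum_columns by (simp add: split_def)
    also have "\<dots> = (\<Sum>q\<in>?Q. \<Sum>(m, V)\<in>(SIGMA m:snd (snd q). ?P q m). ?g q m V)"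
      using fS' by (intro sum.Sigma[symmetric] ballI finite_SigmaI) (auto simp: finite_open_tableaux)
    also have "\<dots> = (\<Sum>q\<in>?Q. \<Sum>m\<in>snd (snd q). \<Sum>V\<in>?P q m. ?g q m V)"
      using fS' by (intro sum.cong refl sum.Sigma[symmetric]) auto
    also have "\<dots> = (\<Sum>(R, X, S)\<in>?Q. ?u (R, X, S) * ((a + t) * (1 + a) ^ card S
         - (1 + a) * a ^ card S + (if S = {} then 1 - t else 0)))"
    proof (intro sum.cong refl)
      fix q assume q: "q \<in> ?Q"
      show "(\<Sum>m\<in>snd (snd q). \<Sum>V\<in>Pow {r \<in> snd (snd q). m \<le> r}.
        ?u q * ((if {r\<in>snd (snd q). r < m} = {} then t else 1) *
         (a ^ card {r\<in>snd (snd q). r < m} * a ^ card V))) =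
        (case q of (R, X, S) \<Rightarrow> ?u (R, X, S) * ((a + t) * (1 + a) ^ card S
         - (1 + a) * a ^ card S + (if S = {} then 1 - t else 0)))"
        unfolding split_def sum_initial_segments_weighted[OF fS'[OF q], symmetric]
        using fS'[OF q] by (simp add: sum_Pow_power_card flip: sum_distrib_left)
    qed
    finally show ?thesis .
  qed
  moreover have "open_sum t (Suc n) a =
      (\<Sum>q\<in>{q \<in> open_tableaux (Suc n). Suc n \<in> fst q}. open_weight t a (Suc n) q) +
      (\<Sum>q\<in>{q \<in> open_tableaux (Suc n). Suc n \<notin> fst q}. open_weight t a (Suc n) q)"
    unfolding open_sum_def
    by (subst sum.union_disjoint[symmetric])
       (auto simp: finite_open_tableaux intro!: sum.cong)
  ultimately have "open_sum t (Suc n) a = (\<Sum>q\<in>?Q. open_weight t a n q * (1 + a) +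
      (case q of (R, X, S) \<Rightarrow> ?u (R, X, S) * ((a + t) * (1 + a) ^ card S - (1 + a) * a ^ card S
         + (if S = {} then 1 - t else 0))))"
    by (simp only: sum.distrib)
  also have "\<dots> = (\<Sum>q\<in>?Q. (t + a) * open_weight t (1 + a) n q + (1 - t) * open_weight t 0 n q)"
  proof (intro sum.cong refl)
    fix q assume q: "q \<in> ?Q"
    obtain R X S where [simp]: "q = (R, X, S)" by (cases q)
    \<comment> \<open>Since 0^0 = 1, this power is the indicator of having no open rows, which
      identifies the correction term with the weight at 0.\<close>
    have "(0::'a) ^ card S = (if S = {} then 1 else 0)"
      using fS[of R X S n] q by (simp add: power_0_left)
    then show "open_weight t a n q * (1 + a) + (case q of (R, X, S) \<Rightarrow> ?u (R, X, S) *
        ((a + t) * (1 + a) ^ card S - (1 + a) * a ^ card S + (if S = {} then 1 - t else 0))) =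
        (t + a) * open_weight t (1 + a) n q + (1 - t) * open_weight t 0 n q"
      by (simp add: open_weight_def algebra_simps)
  qed
  finally show ?thesis
    by (simp only: open_sum_def sum.distrib sum_distrib_left)
qed

lemma open_sum_0: "open_sum t 0 a = 1"
proof -
  have "open_tableaux 0 = {({}, {}, {})}"
    by (auto simp: open_tableaux_def)
  then show ?thesis by (simp add: open_sum_def open_weight_def free_columns_def)
qed

text \<open>Unrolling the recurrence: after k steps \<open>a\<close> has moved to a + k and the
  factors t + a, t + a + 1, ... have accumulated to (t + a)_k, which multiplies the inhomogeneous
  term of that step.\<close>

lemma open_sum_eq_pochhammer:
  fixes a t :: "'a::comm_ring_1"
  shows "open_sum t n a = pochhammer (t + a) n +
    (1 - t) * (\<Sum>k<n. pochhammer (t + a) k * open_sum t (n - Suc k) 0)"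
proof (induction n arbitrary: a)
  case (Suc n)
  have "(\<Sum>k<Suc n. pochhammer (t + a) k * open_sum t (Suc n - Suc k) 0) =
    open_sum t n 0 + (t + a) * (\<Sum>k<n. pochhammer (t + (1 + a)) k * open_sum t (n - Suc k) 0)"
    by (subst sum.lessThan_Suc_shift)
       (simp add: pochhammer_rec sum_distrib_left mult_ac add_ac)
  then show ?case
    unfolding open_sum_Suc Suc.IH[of "1 + a"] by (simp add: pochhammer_rec algebra_simps)
qed (simp add: open_sum_0)

section \<open>Permutation tableaux as tableaux without open rows\<close>

text \<open>A 0/1 filling is determined by the set of its ones, and with no open rows
  \<open>left_one\<close> becomes \<open>one_to_left\<close>. The witnesses \<open>?i\<close> and
  \<open>?j\<close> pass between the two encodings.\<close>

lemma sum_permutation_tableaux: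
  fixes t :: "'a::comm_ring_1"
  shows "(\<Sum>T\<in>permutation_tableaux n. t ^ urc T) = open_sum t n 0"
proof -
  let ?Q = "{q \<in> open_tableaux n. snd (snd q) = {}}"
  let ?D = "\<lambda>R. \<lparr>row_labels = R, col_labels = {1..n} - R\<rparr>"
  let ?i = "\<lambda>(R, X, S). (?D R, \<lambda>p. if p \<in> cells (?D R) then if p \<in> X then 1 else 0 else undefined)"
  let ?j = "\<lambda>T::tableau. (row_labels (fst T), {p \<in> cells (fst T). snd T p = 1}, {})"
  have T: "col_labels (fst T) = {1..n} - row_labels (fst T)" "row_labels (fst T) \<subseteq> {1..n}"
     "p \<notin> cells (fst T) \<Longrightarrow> snd T p = undefined"
     "p \<in> cells (fst T) \<Longrightarrow> snd T p \<noteq> 1 \<longleftrightarrow> snd T p = 0"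
    if "T \<in> permutation_tableaux n" for T p
    using that by (cases p; auto simp: permutation_tableaux_def ferrers_diagrams_def fillings_def
        PiE_def extensional_def Pi_def)+
  \<comment> \<open>Every element of \<open>X\<close> is a cell of the diagram, so the filling built
    from \<open>X\<close> has exactly \<open>X\<close> as its set of ones.\<close>
  have X: "p \<in> cells (?D R) \<and> (if p \<in> cells (?D R) then if p \<in> X then 1 else 0 else undefined) =
      (1::nat) \<longleftrightarrow> p \<in> X" if "(R, X, S) \<in> open_tableaux n" for R X S p
    using open_tableauxD(3)[OF that] by (cases p) (auto simp: cells_def)
  have "(\<Sum>T\<in>permutation_tableaux n. t ^ urc T) = (\<Sum>q\<in>?Q. t ^ card (free_columns n q))"
  proof (rule sum.reindex_bij_witness[of _ ?i ?j])
    show "?i (?j T) = T" if "T \<in> permutation_tableaux n" for T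
    proof -
      have "?D (row_labels (fst T)) = fst T" using T(1)[OF that] by (intro ferrers.equality) simp_all
      then show ?thesis using T(3,4)[OF that] by (intro prod_eqI) (auto simp: fun_eq_iff)
    qed
    show "?j (?i q) = q" if Q0: "q \<in> ?Q" for q
    proof -
      obtain R X where q: "q = (R, X, {})" and Q: "(R, X, {}) \<in> open_tableaux n"
        using Q0 by (cases q) auto
      show ?thesis unfolding q
        by (simp only: prod.case fst_conv snd_conv X[OF Q] ferrers.select_convs Collect_mem_eq)
    qed
    show "?j T \<in> ?Q" if P: "T \<in> permutation_tableaux n" for T
    proof -
      note T' = T[OF P]
      have "?j T \<in> open_tableaux n"
      proof (rule open_tableauxI)
        show "r \<in> row_labels (fst T) \<and> c \<in> {1..n} - row_labels (fst T) \<and> r < c"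
          if "(r, c) \<in> {p \<in> cells (fst T). snd T p = 1}" for r c
          using that T'(1) by (auto simp: cells_def)
        show "\<exists>r. (r, c) \<in> {p \<in> cells (fst T). snd T p = 1}"
          if "c \<in> {1..n} - row_labels (fst T)" for c
          using that T'(1) P by (auto simp: permutation_tableaux_def)
        show "\<not> left_one {p \<in> cells (fst T). snd T p = 1} {} r c"
          if "r \<in> row_labels (fst T)" "c \<in> {1..n} - row_labels (fst T)" "r < c"
            "(r, c) \<notin> {p \<in> cells (fst T). snd T p = 1}" "r' < r"
            "(r', c) \<in> {p \<in> cells (fst T). snd T p = 1}" for r c r'
        proof -
          have "(r, c) \<in> cells (fst T)" using that T'(1) by (simp add: cells_def)
          moreover from this have "snd T (r, c) = 0" using that T'(4) by blast
          moreover have "one_above T r c" using that by (auto simp: one_above_def)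
          ultimately have "\<not> one_to_left T r c"
            using P unfolding permutation_tableaux_def by blast
          then show ?thesis by (simp add: left_one_def one_to_left_def)
        qed
      qed (use T'(2) in auto)
      then show ?thesis by simp
    qed
    show "?i q \<in> permutation_tableaux n" if Q0: "q \<in> ?Q" for q
    proof -
      obtain R X where q: "q = (R, X, {})" and Q: "(R, X, {}) \<in> open_tableaux n"
        using Q0 by (cases q) auto
      note D = open_tableauxD[OF Q]
      let ?f = "\<lambda>p. if p \<in> cells (?D R) then if p \<in> X then 1 else 0 else undefined :: nat"
      note X = X[OF Q]
      have "one_above (?D R, ?f) r c \<longleftrightarrow> (\<exists>r'<r. (r', c) \<in> X)" for r c
        by (simp only: one_above_def fst_conv snd_conv X)
      moreover have "one_to_left (?D R, ?f) r c \<longleftrightarrow> left_one X {} r c" for r c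
        by (simp only: one_to_left_def left_one_def fst_conv snd_conv X empty_iff simp_thms)
      moreover have "?f \<in> fillings (?D R)" by (auto simp: fillings_def split: if_splits)
      moreover have "?D R \<in> ferrers_diagrams n" using D(1) by (auto simp: ferrers_diagrams_def)
      moreover have "\<exists>r. (r, c) \<in> cells (?D R) \<and> ?f (r, c) = 1" if "c \<in> {1..n} - R" for c
        unfolding X using D(4)[OF that] .
      moreover have "\<not> left_one X {} r c"
        if "(r, c) \<in> cells (?D R)" "?f (r, c) = 0" "\<exists>r'<r. (r', c) \<in> X" for r c
        using D(5)[of r c] that by (auto simp: cells_def split: if_splits)
      ultimately have "(?D R, ?f) \<in> permutation_tableaux n"
        unfolding permutation_tableaux_def mem_Collect_eq fst_conv snd_conv ferrers.select_convs
        by (intro conjI ballI notI) (blast | (elim bexE, blast))+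
      then show ?thesis unfolding q by simp
    qed
    show "t ^ card (free_columns n (?j T)) = t ^ urc T" if "T \<in> permutation_tableaux n" for T
    proof -
      note T' = T[OF that]
      have L: "left_one {p \<in> cells (fst T). snd T p = 1} {} r c \<longleftrightarrow> one_to_left T r c" for r c
        by (auto simp: left_one_def one_to_left_def)
      have cell: "(r, c) \<in> cells (fst T) \<longleftrightarrow> r \<in> row_labels (fst T) \<and> r < c"
        if "c \<in> col_labels (fst T)" for r c
        using that by (simp add: cells_def)
      have "c \<in> free_columns n (?j T) \<longleftrightarrow> c \<in> col_labels (fst T) \<and>
          (\<forall>r. (r, c) \<in> cells (fst T) \<longrightarrow> snd T (r, c) \<noteq> 1 \<longrightarrow> \<not> one_to_left T r c)" for c
        unfolding free_columns_def prod.case L T'(1)[symmetric] using cell by auto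
      then have "free_columns n (?j T) = {c. unrestricted_column T c}"
        unfolding unrestricted_column_def using T'(4) by blast
      then show ?thesis by (simp add: urc_def)
    qed
  qed
  also have "\<dots> = (\<Sum>q\<in>?Q. open_weight t 0 n q)"
    by (intro sum.cong) (auto simp: open_weight_def)
  also have "\<dots> = open_sum t n 0"
    unfolding open_sum_def
  \<comment> \<open>At a = 0 a tableau with an open row has weight 0, so the sum may be extended to
    all open tableaux.\<close>
  proof (rule sum.mono_neutral_left[OF finite_open_tableaux])
    have "card (snd (snd q)) \<noteq> 0" if "q \<in> open_tableaux n - ?Q" for q
      using that open_tableaux_finite_rows(2) by (cases q) auto
    then show "\<forall>q\<in>open_tableaux n - ?Q. open_weight t 0 n q = 0"
      by (intro ballI) (simp only: open_weight_def power_0_left if_False mult_zero_right)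
  qed auto
  finally show ?thesis .
qed

section \<open>The identity of power series\<close>

theorem theorem1p1:
  shows "Abs_fps (\<lambda>n. \<Sum>T \<in> permutation_tableaux n. poly_t ^ urc T) =
         fps_quotient (1 + E_t) (1 + fps_const (poly_t - 1) * fps_X * E_t)"
proof -
  define P where "P = Abs_fps (\<lambda>n. open_sum poly_t n 0)"
  define R where "R = Abs_fps (pochhammer poly_t)"
  define s where "s = fps_const (poly_t - 1) * fps_X"
  have s_0: "fps_nth s 0 = 0" by (simp add: s_def)
  have s_nth: "fps_nth (s * F) n = (case n of 0 \<Rightarrow> 0 | Suc m \<Rightarrow> (poly_t - 1) * fps_nth F m)" for F n
    by (simp add: s_def mult.assoc split: nat.split)
  \<comment> \<open>This is \<open>open_sum_eq_pochhammer\<close> at a = 0 in terms of generating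
    functions; the factor x in \<open>s\<close> accounts for the shift in
    \<open>n - Suc k\<close>.\<close>
  have PR: "P * (1 + s * R) = R"
  proof (rule fps_ext)
    fix n
    have "fps_nth (s * (R * P)) n =
        (poly_t - 1) * (\<Sum>k<n. pochhammer poly_t k * open_sum poly_t (n - Suc k) 0)"
      unfolding s_nth
      by (cases n) (simp_all add: fps_mult_nth R_def P_def atLeast0AtMost lessThan_Suc_atMost)
    then have "fps_nth (P + s * (R * P)) n = fps_nth R n"
      using open_sum_eq_pochhammer[of poly_t n 0] by (simp add: P_def R_def algebra_simps)
    then show "fps_nth (P * (1 + s * R)) n = fps_nth R n"
      by (simp add: algebra_simps)
  qed
  \<comment> \<open>Comparing coefficients of x^(n+1): (t)_(n+1) - (t - 1) (t)_n = (t + n - t + 1)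
    (t)_n = (n + 1) (t)_n.\<close>
  have E: "1 + E_t = (1 - s) * R"
  proof (rule fps_ext)
    fix n
    show "fps_nth (1 + E_t) n = fps_nth ((1 - s) * R) n"
      by (cases n)
         (simp_all add: left_diff_distrib s_0 s_nth E_t_def R_def pochhammer_Suc algebra_simps)
  qed
  have "(1 + s * E_t) * P = 1 + E_t"
  proof -
    \<comment> \<open>The denominator acquires the factor 1 - s too, so \<open>PR\<close> multiplied
      by 1 - s is the claim and no division is required.\<close>
    have "1 + s * E_t = 1 - s + s * (1 + E_t)" by (simp add: algebra_simps)
    also have "\<dots> = (1 - s) * (1 + s * R)" unfolding E by (simp add: algebra_simps)
    finally have "(1 + s * E_t) * P = (1 - s) * (P * (1 + s * R))" by (simp only: mult_ac)
    then show ?thesis unfolding PR E .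
  qed
  then show ?thesis
    unfolding sum_permutation_tableaux P_def[symmetric]
    by (subst fps_quotient_eq_iff[OF denominator_nth_0]) (simp add: s_def)
qed

end
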